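(* Let $A$ be a $k\times k$ complex matrix, and let $\chi_A(x)=(x-\alpha_1)^{m_1}(x-\alpha_2)^{m_2}\cdots(x-\alpha_s)^{m_s}$ be its characteristic polynomial, where $\alpha_1,\ldots,\alpha_s$ are distinct complex numbers, $\alpha_1=0$, $m_1\ge 0$ (possibly $m_1=0$), and $m_j\ge 1$ for $j\ge 2$. For $j=1,\ldots,s$ and $r=0,1$ put $B_{jr}=L_{jr}(A)[\chi_A]$. Then the Chevalley--Jordan decomposition of $A$ is $A=D+N$, where $$N=B_{11}+B_{21}+\cdots+B_{s1}$$ is the nilpotent part and $$D=\alpha_2B_{20}+\alpha_3B_{30}+\cdots+\alpha_sB_{s0}$$ is the diagonalizable part. Moreover, $B_{10},B_{20},\ldots,B_{s0}$ are the spectral projections of $A$ at $\alpha_1,\alpha_2,\ldots,\alpha_s$, respectively.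
   Context: For a non-constant polynomial $P(x)=(x-\alpha_1)^{m_1}\cdots(x-\alpha_s)^{m_s}$ with $\alpha_1,\ldots,\alpha_s\in\mathbb{C}$ distinct and $m_1,\ldots,m_s$ nonnegative integers, set, for $1\le j\le s$, $P_j(x)=\prod_{i\ne j}(x-\alpha_i)^{m_i}=P(x)/(x-\alpha_j)^{m_j}$ and $g_j(x)=1/P_j(x)$. For $1\le j\le s$ and $r\ge 0$ define the polynomial $$L_{jr}(x)[P]=P_j(x)(x-\alpha_j)^{r}\sum_{i=0}^{m_j-1-r}\frac{1}{i!}g_j^{(i)}(\alpha_j)(x-\alpha_j)^i,$$ where an empty sum is zero (so $L_{jr}(x)[P]=0$ when $r\ge m_j$). $L_{jr}(A)[P]$ denotes the evaluation of this polynomial at the matrix $A$. The Chevalley--Jordan decomposition of $A$ is the unique decomposition $A=D+N$ with $D$ diagonalizable (over $\mathbb{C}$), $N$ nilpotent and $DN=ND$. The spectral projection of $A$ at $\alpha$ is the projection onto the generalized eigenspace $\bigcup_n\ker(A-\alpha I)^n$ along the sum of the generalized eigenspaces of $A$ for its eigenvalues other than $\alpha$ (it is zero if $\alpha$ is not an eigenvalue). *)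

theory Defs
  imports
    "HOL-Analysis.Derivative"
    "Jordan_Normal_Form.Matrix_Kernel"
    "Jordan_Normal_Form.Char_Poly"
begin

text \<open>A polynomial \<open>P\<close> is presented by its factorisation data: the number \<open>s\<close> of listed points,
  the points \<open>\<alpha> 1, \<dots>, \<alpha> s\<close> and the multiplicities \<open>m 1, \<dots>, m s\<close>. A multiplicity may be zero,
  so a listed point need not be a root of \<open>P\<close>. Values outside \<open>{1..s}\<close> are never used.\<close>

definition prod_poly :: "nat \<Rightarrow> (nat \<Rightarrow> complex) \<Rightarrow> (nat \<Rightarrow> nat) \<Rightarrow> complex poly" where
  "prod_poly s \<alpha> m = (\<Prod>i\<in>{1..s}. [:- \<alpha> i, 1:] ^ m i)"

definition cofactor_poly :: "nat \<Rightarrow> (nat \<Rightarrow> complex) \<Rightarrow> (nat \<Rightarrow> nat) \<Rightarrow> nat \<Rightarrow> complex poly" where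
  "cofactor_poly s \<alpha> m j = (\<Prod>i\<in>{1..s} - {j}. [:- \<alpha> i, 1:] ^ m i)"

definition recip_cofactor ::
    "nat \<Rightarrow> (nat \<Rightarrow> complex) \<Rightarrow> (nat \<Rightarrow> nat) \<Rightarrow> nat \<Rightarrow> complex \<Rightarrow> complex" where
  "recip_cofactor s \<alpha> m j x = 1 / poly (cofactor_poly s \<alpha> m j) x"

text \<open>The sum runs over \<open>i \<le> m j - 1 - r\<close>, i.e. over \<open>i < m j - r\<close>; truncated subtraction
  makes it empty exactly when \<open>r \<ge> m j\<close>.\<close>

definition L_poly ::
    "nat \<Rightarrow> (nat \<Rightarrow> complex) \<Rightarrow> (nat \<Rightarrow> nat) \<Rightarrow> nat \<Rightarrow> nat \<Rightarrow> complex poly" where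
  "L_poly s \<alpha> m j r =
     cofactor_poly s \<alpha> m j * [:- \<alpha> j, 1:] ^ r *
     (\<Sum>i<m j - r. smult (1 / fact i * (deriv ^^ i) (recip_cofactor s \<alpha> m j) (\<alpha> j))
                         ([:- \<alpha> j, 1:] ^ i))"

text \<open>Matrices of a fixed size carried by the type \<open>complex mat\<close> do not form a type-class
  monoid, so sums are taken in the ring of \<open>k \<times> k\<close> matrices.\<close>

definition finsum_mat :: "nat \<Rightarrow> ('b \<Rightarrow> complex mat) \<Rightarrow> 'b set \<Rightarrow> complex mat" where
  "finsum_mat k f I = finsum (ring_mat TYPE(complex) k ()) f I"

definition poly_mat :: "nat \<Rightarrow> complex poly \<Rightarrow> complex mat \<Rightarrow> complex mat" where
  "poly_mat k p A = finsum_mat k (\<lambda>i. coeff p i \<cdot>\<^sub>m (A ^\<^sub>m i)) {..degree p}"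

definition diagonalizable_mat :: "complex mat \<Rightarrow> bool" where
  "diagonalizable_mat D \<longleftrightarrow> (\<exists>E. diagonal_mat E \<and> similar_mat D E)"

definition nilpotent_mat :: "nat \<Rightarrow> complex mat \<Rightarrow> bool" where
  "nilpotent_mat k N \<longleftrightarrow> N \<in> carrier_mat k k \<and> (\<exists>n. N ^\<^sub>m n = 0\<^sub>m k k)"

definition chevalley_jordan_pair ::
    "nat \<Rightarrow> complex mat \<Rightarrow> complex mat \<Rightarrow> complex mat \<Rightarrow> bool" where
  "chevalley_jordan_pair k A D N \<longleftrightarrow>
     D \<in> carrier_mat k k \<and> N \<in> carrier_mat k k \<and>
     A = D + N \<and> diagonalizable_mat D \<and> nilpotent_mat k N \<and> D * N = N * D"

definition is_chevalley_jordan_decomposition ::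
    "nat \<Rightarrow> complex mat \<Rightarrow> complex mat \<Rightarrow> complex mat \<Rightarrow> bool" where
  "is_chevalley_jordan_decomposition k A D N \<longleftrightarrow>
     chevalley_jordan_pair k A D N \<and>
     (\<forall>D' N'. chevalley_jordan_pair k A D' N' \<longrightarrow> D' = D \<and> N' = N)"

text \<open>\<open>char_matrix A a\<close> is \<open>A - a I\<close>.\<close>

definition gen_eigenspace :: "complex mat \<Rightarrow> complex \<Rightarrow> complex vec set" where
  "gen_eigenspace A a = (\<Union>n. mat_kernel (char_matrix A a ^\<^sub>m n))"

definition sum_other_gen_eigenspaces ::
    "nat \<Rightarrow> complex mat \<Rightarrow> complex \<Rightarrow> complex vec set" where
  "sum_other_gen_eigenspaces k A a =
     (let E = {b. eigenvalue A b \<and> b \<noteq> a}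
      in {finsum_vec TYPE(complex) k v E | v. \<forall>b\<in>E. v b \<in> gen_eigenspace A b})"

text \<open>An idempotent matrix is determined by its range and its kernel, and these are then
  complementary subspaces.\<close>

definition is_projection_onto_along ::
    "nat \<Rightarrow> complex mat \<Rightarrow> complex vec set \<Rightarrow> complex vec set \<Rightarrow> bool" where
  "is_projection_onto_along k B U W \<longleftrightarrow>
     B \<in> carrier_mat k k \<and> B * B = B \<and>
     (\<lambda>v. B *\<^sub>v v) ` carrier_vec k = U \<and> mat_kernel B = W"

text \<open>If \<open>a\<close> is not an eigenvalue of \<open>A\<close>, the range demanded here is the zero space, so the
  spectral projection is the zero matrix.\<close>

definition is_spectral_projection ::
    "nat \<Rightarrow> complex mat \<Rightarrow> complex \<Rightarrow> complex mat \<Rightarrow> bool" where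
  "is_spectral_projection k A a B \<longleftrightarrow>
     is_projection_onto_along k B (gen_eigenspace A a) (sum_other_gen_eigenspaces k A a)"

end

theory Submission
  imports
    Defs
    "HOL-Analysis.FPS_Convergence"
    "HOL-Number_Theory.Cong"
    "HOL-Computational_Algebra.Field_as_Ring"
    "Jordan_Normal_Form.Jordan_Normal_Form_Existence"
    "Jordan_Normal_Form.Jordan_Normal_Form_Uniqueness"
begin

text \<open>
  By the Chinese remainder theorem, the ring \<open>\<complex>[x]/P\<close>, with \<open>P\<close> the characteristic polynomial, is
  the product of the rings \<open>\<complex>[x]/(x - \<alpha> i) ^ m i\<close>. Since \<open>L j 0\<close> is the cofactor of
  \<open>(x - \<alpha> j) ^ m j\<close> times a truncation of the Taylor series of its reciprocal
  (\<open>reciprocal_taylor_poly_inverse\<close>), it is \<open>1\<close> modulo the \<open>j\<close>-th factor and \<open>0\<close> modulo the others.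
  So the \<open>L j 0\<close> are orthogonal idempotents with sum \<open>1\<close>, and a combination
  \<open>interp c = (\<Sum>j. c j L j 0)\<close> is the constant \<open>c i\<close> modulo the \<open>i\<close>-th factor.

  By the theorem of Cayley and Hamilton, evaluation at \<open>A\<close> is a ring homomorphism that depends on a
  polynomial only modulo \<open>P\<close> (\<open>ev_cong\<close>). The proposed diagonalizable part is the value of
  \<open>interp \<alpha>\<close>. Because \<open>L j 1 = (x - \<alpha> j) L j 0\<close> modulo \<open>P\<close>, the proposed nilpotent part is the
  value of \<open>x - interp \<alpha>\<close>, and this polynomial is nilpotent modulo \<open>P\<close>. Both parts are polynomials
  in \<open>A\<close>, so they commute. The value of \<open>interp \<alpha>\<close> is diagonalizable because a generalized
  eigenvector of it is already an eigenvector (\<open>ev_interp_diagonalizable\<close>).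

  The link to generalized eigenspaces is \<open>interp_on_gen_eigenspace\<close>: a generalized eigenvector of
  \<open>A\<close> at \<open>\<alpha> j\<close> is killed by every other idempotent, so \<open>interp c\<close> acts on it as the scalar \<open>c j\<close>.
  With the \<open>j\<close>-th unit vector for \<open>c\<close> this identifies the spectral projections. With
  \<open>c = \<alpha>\<close> it gives uniqueness: in any other decomposition \<open>A = D' + N'\<close> the eigenvectors of \<open>D'\<close> are
  generalized eigenvectors of \<open>A\<close> for the same eigenvalue, so \<open>D'\<close> agrees with the value of
  \<open>interp \<alpha>\<close> on a basis.
\<close>

section \<open>Idempotents modulo a factored polynomial\<close>

text \<open>The Taylor series of \<open>1 / p\<close> at \<open>a\<close> is the inverse of \<open>p\<close> as a formal power series in
  \<open>x - a\<close>; cutting it off after \<open>n\<close> terms spoils the product with \<open>p\<close> only from the term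
  \<open>(x - a) ^ n\<close> on. After the shift \<open>x \<mapsto> a + x\<close> the expansion is at \<open>0\<close>, so that
  polynomials can be compared with power series coefficient by coefficient.\<close>

lemma reciprocal_taylor_poly_inverse:
  fixes p :: "complex poly"
  assumes "poly p a \<noteq> 0"
  shows "[:- a, 1:] ^ n dvd
    p * (\<Sum>i<n. smult (1 / fact i * (deriv ^^ i) (\<lambda>x. 1 / poly p x) a) ([:- a, 1:] ^ i)) - 1"
proof -
  define q where "q = pcompose p [:a, 1:]"
  define F where "F = inverse (fps_of_poly q)"
  have poly_q: "poly q z = poly p (a + z)" for z
    by (simp add: q_def poly_pcompose)
  have q0: "coeff q 0 \<noteq> 0"
    using assms poly_q[of 0] by (simp add: poly_0_coeff_0)
  have "(\<lambda>z. poly q z) has_fps_expansion fps_of_poly q"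
    by (simp add: has_fps_expansion_def)
  then have "(\<lambda>z. inverse (poly q z)) has_fps_expansion F"
    unfolding F_def by (rule has_fps_expansion_inverse) (simp add: q0)
  then have F_nth: "fps_nth F i = 1 / fact i * (deriv ^^ i) (\<lambda>x. 1 / poly p x) a" for i
    by (subst higher_deriv_shift_0)
      (simp add: fps_nth_fps_expansion o_def poly_q field_simps)
  define T where "T = (\<Sum>i<n. monom (fps_nth F i) i)"
  have coeff_T: "coeff T i = fps_nth F i" if "i < n" for i
    using that by (simp add: T_def coeff_sum coeff_monom)
  have qF: "fps_of_poly q * F = 1"
    unfolding F_def using q0 by (simp add: inverse_mult_eq_1')
  have "coeff (q * T - 1) i = 0" if "i < n" for i
  proof -
    have "coeff (q * T) i = fps_nth (fps_of_poly q * F) i"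
      using that by (simp add: coeff_mult fps_mult_nth atLeast0AtMost coeff_T)
    then show ?thesis by (simp add: qF coeff_1)
  qed
  then have "monom 1 n dvd q * T - 1"
    by (simp add: monom_1_dvd_iff')
  then obtain h where h: "q * T - 1 = monom 1 n * h" by (elim dvdE)
  \<comment> \<open>Substituting \<open>x - a\<close> undoes the shift.\<close>
  have pc_pow: "pcompose (f ^ i) [:- a, 1:] = pcompose f [:- a, 1:] ^ i" for f i
    by (induction i) (simp_all add: pcompose_mult)
  have pc_monom: "pcompose (monom c i) [:- a, 1:] = smult c ([:- a, 1:] ^ i)" for c i
    by (simp add: monom_altdef pcompose_smult pc_pow pcompose_pCons)
  have "pcompose q [:- a, 1:] = p"
    by (simp add: q_def flip: pcompose_assoc)
  moreover have "pcompose T [:- a, 1:] =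
      (\<Sum>i<n. smult (1 / fact i * (deriv ^^ i) (\<lambda>x. 1 / poly p x) a) ([:- a, 1:] ^ i))"
    by (simp add: T_def pcompose_sum pc_monom F_nth)
  moreover have "pcompose (q * T - 1) [:- a, 1:] = [:- a, 1:] ^ n * pcompose h [:- a, 1:]"
    by (simp add: h pcompose_mult pc_monom)
  ultimately show ?thesis
    by (simp add: pcompose_diff pcompose_mult)
qed

lemma coprime_linear_powers:
  fixes a b :: complex
  assumes "a \<noteq> b"
  shows "coprime ([:- a, 1:] ^ n) ([:- b, 1:] ^ l)"
proof -
  have "c dvd 1" if "c dvd [:- a, 1:]" "c dvd [:- b, 1:]" for c
  proof -
    have "c dvd [:- b, 1:] - [:- a, 1:]" using that(2,1) by (rule Rings.dvd_diff)
    then have "c dvd [:a - b:]" by simp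
    also have "[:a - b:] dvd 1" using assms by (simp add: is_unit_triv)
    finally show ?thesis .
  qed
  then have "coprime [:- a, 1:] [:- b, 1:]" by (auto simp: coprime_def)
  then show ?thesis by simp
qed

locale factorisation =
  fixes s :: nat and \<alpha> :: "nat \<Rightarrow> complex" and m :: "nat \<Rightarrow> nat"
  assumes inj: "inj_on \<alpha> {1..s}"
begin

abbreviation "P \<equiv> prod_poly s \<alpha> m"
abbreviation "L \<equiv> L_poly s \<alpha> m"

lemma prod_eq_cofactor: "j \<in> {1..s} \<Longrightarrow> P = [:- \<alpha> j, 1:] ^ m j * cofactor_poly s \<alpha> m j"
  unfolding prod_poly_def cofactor_poly_def by (simp add: prod.remove)

lemma cong_prod_polyI:
  assumes "\<And>i. i \<in> {1..s} \<Longrightarrow> [f = g] (mod [:- \<alpha> i, 1:] ^ m i)"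
  shows "[f = g] (mod P)"
  unfolding prod_poly_def
proof (rule cong_cong_prod_coprime)
  show "\<forall>i\<in>{1..s}. \<forall>j\<in>{1..s}. i \<noteq> j \<longrightarrow> coprime ([:- \<alpha> i, 1:] ^ m i) ([:- \<alpha> j, 1:] ^ m j)"
    using inj by (intro ballI impI coprime_linear_powers) (auto dest: inj_onD)
qed (use assms in auto)

lemma L0_cong_one:
  assumes "j \<in> {1..s}"
  shows "[L j 0 = 1] (mod [:- \<alpha> j, 1:] ^ m j)"
proof -
  have "poly (cofactor_poly s \<alpha> m j) (\<alpha> j) \<noteq> 0"
    using inj_onD[OF inj] assms by (fastforce simp: cofactor_poly_def poly_prod)
  from reciprocal_taylor_poly_inverse[OF this, of "m j"] show ?thesis
    by (simp add: cong_iff_dvd_diff L_poly_def recip_cofactor_def[abs_def])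
qed

lemma L0_cong_zero:
  assumes "i \<in> {1..s}" "i \<noteq> j"
  shows "[L j 0 = 0] (mod [:- \<alpha> i, 1:] ^ m i)"
proof -
  have "[:- \<alpha> i, 1:] ^ m i dvd cofactor_poly s \<alpha> m j"
    unfolding cofactor_poly_def using assms by (intro dvd_prodI) auto
  then show ?thesis unfolding cong_0_iff L_poly_def by (intro dvd_mult2)
qed

text \<open>Multiplying \<open>L j 0\<close> by \<open>x - \<alpha> j\<close> raises every Taylor term by one degree. The top term
  then contains \<open>(x - \<alpha> j) ^ m j\<close> and the cofactor, so it is a constant multiple of \<open>P\<close>, and the rest is the truncated sum in
  \<open>L j 1\<close>. If \<open>m j = 0\<close>, there is no top term, but then both sides are \<open>0\<close>.\<close>

lemma L1_cong:
  assumes "j \<in> {1..s}"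
  shows "[L j 1 = [:- \<alpha> j, 1:] * L j 0] (mod P)"
proof (cases "m j")
  case 0
  then show ?thesis by (simp add: L_poly_def)
next
  case (Suc n)
  define c where "c = 1 / fact n * (deriv ^^ n) (recip_cofactor s \<alpha> m j) (\<alpha> j)"
  have "[:- \<alpha> j, 1:] * L j 0 = L j 1 + smult c P"
    unfolding L_poly_def Suc prod_eq_cofactor[OF assms] c_def
    by (simp add: algebra_simps del: mult_pCons_left mult_pCons_right)
  then show ?thesis
    by (simp add: cong_iff_dvd_diff dvd_smult)
qed

text \<open>By the Chinese remainder theorem \<open>\<complex>[x]/P\<close> is the product of the rings
  \<open>\<complex>[x]/(x - \<alpha> i) ^ m i\<close>, and the \<open>L j 0\<close> are its primitive idempotents.
  The class of \<open>interp c\<close> is the element with the constant component \<open>c i\<close> in the \<open>i\<close>-th ring.\<close>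

definition interp :: "(nat \<Rightarrow> complex) \<Rightarrow> complex poly" where
  "interp c = (\<Sum>j\<in>{1..s}. smult (c j) (L j 0))"

lemma interp_cong:
  assumes "i \<in> {1..s}"
  shows "[interp c = [:c i:]] (mod [:- \<alpha> i, 1:] ^ m i)"
proof -
  have *: "[smult (c j) (L j 0) = (if j = i then [:c i:] else 0)] (mod [:- \<alpha> i, 1:] ^ m i)"
    if "j \<in> {1..s}" for j
  proof (cases "j = i")
    case True
    with cong_scalar_left[OF L0_cong_one[OF assms], of "[:c i:]"] show ?thesis by simp
  next
    case False
    then have "i \<noteq> j" by simp
    from cong_scalar_left[OF L0_cong_zero[OF assms this], of "[:c j:]"] False show ?thesis by simp
  qed
  have "(\<Sum>j\<in>{1..s}. if j = i then [:c i:] else 0) = [:c i:]"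
    using assms by (simp only: sum.delta sum.delta' finite_atLeastAtMost if_True)
  moreover have "[interp c = (\<Sum>j\<in>{1..s}. if j = i then [:c i:] else 0)] (mod [:- \<alpha> i, 1:] ^ m i)"
    unfolding interp_def by (rule cong_sum) (rule *)
  ultimately show ?thesis by (simp only:)
qed

text \<open>Interpolating polynomials are constants modulo each factor, so identities between them modulo
  \<open>P\<close> reduce to identities between complex numbers.\<close>

lemma interp_unique:
  assumes "\<And>i. i \<in> {1..s} \<Longrightarrow> [f = [:c i:]] (mod [:- \<alpha> i, 1:] ^ m i)"
  shows "[f = interp c] (mod P)"
proof (rule cong_prod_polyI)
  fix i assume i: "i \<in> {1..s}"
  show "[f = interp c] (mod [:- \<alpha> i, 1:] ^ m i)"
    by (rule cong_trans[OF assms[OF i] cong_sym[OF interp_cong[OF i, of c]]])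
qed

lemma interp_mult: "[interp c * interp d = interp (\<lambda>j. c j * d j)] (mod P)"
proof (rule interp_unique)
  fix i assume "i \<in> {1..s}"
  from cong_mult[OF interp_cong[OF this, of c] interp_cong[OF this, of d]]
  show "[interp c * interp d = [:c i * d i:]] (mod [:- \<alpha> i, 1:] ^ m i)"
    by (simp add: mult.commute)
qed

lemma interp_one: "[interp (\<lambda>_. 1) = 1] (mod P)"
  by (rule cong_sym) (rule interp_unique, simp flip: one_pCons)

lemma interp_unit:
  assumes "j \<in> {1..s}" shows "interp (\<lambda>i. if i = j then 1 else 0) = L j 0"
  using assms by (simp add: interp_def if_distrib[of "\<lambda>c. smult c _"] cong: if_cong)

text \<open>Modulo \<open>(x - \<alpha> i) ^ m i\<close> the polynomial \<open>x - interp \<alpha>\<close> is \<open>x - \<alpha> i\<close>, whose powers vanish from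
  the exponent \<open>m i\<close> on; the sum of all \<open>m i\<close> is an exponent that serves every \<open>i\<close>.\<close>

lemma nilpotent_poly:
  "[([:0, 1:] - interp \<alpha>) ^ (\<Sum>i\<in>{1..s}. m i) = 0] (mod P)"
proof (rule cong_prod_polyI)
  fix i assume i: "i \<in> {1..s}"
  let ?M = "\<Sum>i\<in>{1..s}. m i"
  have "m i \<le> ?M" using i by (intro member_le_sum) auto
  have "[[:0, 1:] - interp \<alpha> = [:0, 1:] - [:\<alpha> i:]] (mod [:- \<alpha> i, 1:] ^ m i)"
    by (intro cong_diff cong_refl interp_cong i)
  then have "[([:0, 1:] - interp \<alpha>) ^ ?M = ([:0, 1:] - [:\<alpha> i:]) ^ ?M] (mod [:- \<alpha> i, 1:] ^ m i)"
    by (rule cong_pow)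
  moreover have "[([:0, 1:] - [:\<alpha> i:]) ^ ?M = 0] (mod [:- \<alpha> i, 1:] ^ m i)"
    using \<open>m i \<le> ?M\<close> by (simp add: cong_0_iff le_imp_power_dvd)
  ultimately show "[([:0, 1:] - interp \<alpha>) ^ ?M = 0] (mod [:- \<alpha> i, 1:] ^ m i)"
    by (rule cong_trans)
qed

end

section \<open>Evaluation of polynomials at a square matrix\<close>

lemma mult_mat_zero_vec: "M \<in> carrier_mat n l \<Longrightarrow> M *\<^sub>v 0\<^sub>v l = 0\<^sub>v n"
  by (intro eq_vecI) auto

lemma scalar_mat_mult_vec:
  fixes v :: "'a :: comm_ring_1 vec"
  assumes "v \<in> carrier_vec k"
  shows "(a \<cdot>\<^sub>m 1\<^sub>m k) *\<^sub>v v = a \<cdot>\<^sub>v v"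
proof (rule eq_vecI)
  fix i assume "i < dim_vec (a \<cdot>\<^sub>v v)"
  then have i: "i < k" using assms by simp
  then show "((a \<cdot>\<^sub>m 1\<^sub>m k) *\<^sub>v v) $ i = (a \<cdot>\<^sub>v v) $ i"
    using assms by (simp add: scalar_prod_def mult_delta_left mult_delta_right)
qed (use assms in simp)

lemma finsum_mat_props:
  assumes "finite I" "\<And>x. x \<in> I \<Longrightarrow> f x \<in> carrier_mat k k"
  shows finsum_mat_closed: "finsum_mat k f I \<in> carrier_mat k k"
    and index_finsum_mat: "\<And>i j. i < k \<Longrightarrow> j < k \<Longrightarrow> finsum_mat k f I $$ (i, j) = (\<Sum>x\<in>I. f x $$ (i, j))"
proof -
  interpret R: ring "ring_mat TYPE(complex) k ()" by (rule ring_mat)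
  have "finsum_mat k f I \<in> carrier_mat k k \<and>
    (\<forall>i<k. \<forall>j<k. finsum_mat k f I $$ (i, j) = (\<Sum>x\<in>I. f x $$ (i, j)))"
    using assms
  proof (induction I rule: finite_induct)
    case empty
    then show ?case using R.finsum_empty[of f] by (simp add: finsum_mat_def ring_mat_simps)
  next
    case (insert y I)
    then have "finsum_mat k f (insert y I) = f y + finsum_mat k f I"
      using R.finsum_insert[of I y f] by (auto simp: finsum_mat_def ring_mat_simps)
    with insert show ?case by auto
  qed
  then show "finsum_mat k f I \<in> carrier_mat k k"
    and "\<And>i j. i < k \<Longrightarrow> j < k \<Longrightarrow> finsum_mat k f I $$ (i, j) = (\<Sum>x\<in>I. f x $$ (i, j))"
    by auto
qed

locale complex_square_matrix =
  fixes k :: nat and A :: "complex mat"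
  assumes A: "A \<in> carrier_mat k k"
begin

abbreviation "ev p \<equiv> poly_mat k p A"

lemma pow_closed: "A ^\<^sub>m n \<in> carrier_mat k k"
  using A by (rule pow_carrier_mat)

lemma ev_closed [simp]: "ev p \<in> carrier_mat k k"
  unfolding poly_mat_def using pow_closed by (intro finsum_mat_closed) auto

lemma ev_dim [simp]: "dim_row (ev p) = k" "dim_col (ev p) = k"
  using carrier_matD[OF ev_closed] by auto

text \<open>The upper summation bound is left free, so that polynomials of different degrees can be
  compared.\<close>

lemma ev_index:
  assumes "i < k" "j < k" "degree p \<le> d"
  shows "ev p $$ (i, j) = (\<Sum>n\<le>d. coeff p n * (A ^\<^sub>m n) $$ (i, j))"
proof -
  have "ev p $$ (i, j) = (\<Sum>n\<le>degree p. (coeff p n \<cdot>\<^sub>m (A ^\<^sub>m n)) $$ (i, j))"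
    unfolding poly_mat_def using pow_closed assms by (intro index_finsum_mat) auto
  also have "\<dots> = (\<Sum>n\<le>degree p. coeff p n * (A ^\<^sub>m n) $$ (i, j))"
    using carrier_matD[OF pow_closed] assms by (intro sum.cong refl index_smult_mat(1)) (simp_all del: pow_mat_dim)
  also have "\<dots> = (\<Sum>n\<le>d. coeff p n * (A ^\<^sub>m n) $$ (i, j))"
    using assms by (intro sum.mono_neutral_left) (auto simp: coeff_eq_0)
  finally show ?thesis .
qed

lemma ev_add: "ev (p + q) = ev p + ev q"
proof (rule eq_matI)
  fix i j assume "i < dim_row (ev p + ev q)" "j < dim_col (ev p + ev q)"
  then have ij: "i < k" "j < k" by auto
  let ?d = "max (degree p) (degree q)"
  have "degree (p + q) \<le> ?d" by (rule degree_add_le_max)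
  with ij show "ev (p + q) $$ (i, j) = (ev p + ev q) $$ (i, j)"
    by (simp add: ev_index[where d = ?d] algebra_simps sum.distrib)
qed auto

lemma ev_smult: "ev (smult c p) = c \<cdot>\<^sub>m ev p"
  by (rule eq_matI) (auto simp: ev_index[where d = "degree p"] degree_smult_le sum_distrib_left mult_ac)

lemma ev_zero [simp]: "ev 0 = 0\<^sub>m k k"
  by (rule eq_matI) (auto simp: ev_index[where d = 0])

lemma ev_pCons: "ev (pCons a p) = a \<cdot>\<^sub>m 1\<^sub>m k + ev p * A"
proof (rule eq_matI)
  fix i j assume "i < dim_row (a \<cdot>\<^sub>m 1\<^sub>m k + ev p * A)" "j < dim_col (a \<cdot>\<^sub>m 1\<^sub>m k + ev p * A)"
  with A have ij: "i < k" "j < k" by auto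
  let ?d = "degree p"
  have pow: "(A ^\<^sub>m Suc n) $$ (i, j) = (\<Sum>l<k. (A ^\<^sub>m n) $$ (i, l) * A $$ (l, j))" for n
    using ij A pow_closed[of n] by (simp add: scalar_prod_def atLeast0LessThan)
  have "ev (pCons a p) $$ (i, j) = a * (1\<^sub>m k) $$ (i, j) + (\<Sum>n\<le>?d. coeff p n * (A ^\<^sub>m Suc n) $$ (i, j))"
    using ij A by (subst ev_index[where d = "Suc ?d"])
      (auto simp: degree_pCons_le sum.atMost_Suc_shift simp del: pow_mat.simps(2) sum.atMost_Suc)
  also have "(\<Sum>n\<le>?d. coeff p n * (A ^\<^sub>m Suc n) $$ (i, j)) = (\<Sum>l<k. ev p $$ (i, l) * A $$ (l, j))"
    unfolding pow using ij
    by (simp add: ev_index[where d = ?d] sum_distrib_left sum_distrib_right mult.assoc) (rule sum.swap)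
  also have "a * (1\<^sub>m k) $$ (i, j) + \<dots> = (a \<cdot>\<^sub>m 1\<^sub>m k + ev p * A) $$ (i, j)"
    using ij A by (simp add: scalar_prod_def atLeast0LessThan)
  finally show "ev (pCons a p) $$ (i, j) = (a \<cdot>\<^sub>m 1\<^sub>m k + ev p * A) $$ (i, j)" .
qed (use A in auto)

lemma ev_one [simp]: "ev 1 = 1\<^sub>m k"
  using A by (intro eq_matI) (auto simp: one_pCons ev_pCons)

lemma ev_linear: "ev [:- a, 1:] = char_matrix A a"
  using A by (intro eq_matI) (auto simp: ev_pCons char_matrix_def)

lemma ev_X: "ev [:0, 1:] = A"
  using A by (intro eq_matI) (auto simp: ev_pCons)

lemma ev_mult: "ev (p * q) = ev p * ev q"
proof (induction q)
  case 0
  show ?case by (simp add: right_mult_zero_mat[OF ev_closed])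
next
  case (pCons a q)
  have "ev (p * pCons a q) = a \<cdot>\<^sub>m ev p + ev p * ev q * A"
    using A by (intro eq_matI) (auto simp: ev_add ev_smult ev_pCons pCons.IH)
  also have "\<dots> = ev p * (a \<cdot>\<^sub>m 1\<^sub>m k + ev q * A)"
    by (simp add: mult_add_distrib_mat[OF ev_closed smult_carrier_mat[OF one_carrier_mat]
          mult_carrier_mat[OF ev_closed A]] mult_smult_distrib[OF ev_closed one_carrier_mat]
        right_mult_one_mat[OF ev_closed] assoc_mult_mat[OF ev_closed ev_closed A])
  finally show ?case by (simp only: ev_pCons)
qed

lemma ev_commute: "ev p * ev q = ev q * ev p"
  by (metis ev_mult mult.commute)

lemma ev_minus: "ev (p - q) = ev p - ev q"
proof -
  have "ev (p - q) = ev p + (-1) \<cdot>\<^sub>m ev q"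
    using ev_add[of p "smult (-1) q"] unfolding ev_smult by simp
  then show ?thesis by (intro eq_matI) auto
qed

lemma ev_power: "ev (p ^ n) = ev p ^\<^sub>m n"
  by (induction n) (simp_all add: power_Suc2 ev_mult del: power_Suc)

lemma ev_sum_index:
  assumes "i < k" "j < k"
  shows "ev (sum f S) $$ (i, j) = (\<Sum>x\<in>S. ev (f x) $$ (i, j))"
  using assms by (induction S rule: infinite_finite_induct) (simp_all add: ev_add)

lemma ev_sum: "finite S \<Longrightarrow> ev (sum f S) = finsum_mat k (\<lambda>x. ev (f x)) S"
  using finsum_mat_closed[of S "\<lambda>x. ev (f x)" k]
  by (intro eq_matI) (auto simp: ev_sum_index index_finsum_mat)

text \<open>Let the indeterminate act on \<open>\<complex>^k\<close> as \<open>A\<close>. The columns of \<open>C = x I - A\<close> then give relations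
  between the unit vectors: the sum over \<open>i\<close> of \<open>C $$ (i, j)\<close> applied to the \<open>i\<close>-th unit vector
  is \<open>0\<close> (\<open>col_C\<close>). Combining these relations with the coefficients \<open>Q $$ (j, l)\<close> of the adjugate
  \<open>Q\<close> and using \<open>C * Q = det C\<close> shows that \<open>det C\<close> kills the \<open>l\<close>-th unit vector. The proof
  carries this out for the entries in a fixed row \<open>r\<close>.\<close>

lemma cayley_hamilton: "ev (char_poly A) = 0\<^sub>m k k"
proof (rule eq_matI)
  fix r l assume "r < dim_row (0\<^sub>m k k :: complex mat)" "l < dim_col (0\<^sub>m k k :: complex mat)"
  then have rl: "r < k" "l < k" by auto
  define C where "C = char_poly_matrix A"
  define Q where "Q = adj_mat C"
  have C: "C \<in> carrier_mat k k" unfolding C_def using A by simp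
  have Q: "Q \<in> carrier_mat k k" and CQ: "C * Q = char_poly A \<cdot>\<^sub>m 1\<^sub>m k"
    using adj_mat(1,2)[OF C] unfolding Q_def C_def char_poly_def by auto
  have col_C: "(\<Sum>i<k. ev (C $$ (i, j)) $$ (t, i)) = 0" if "t < k" "j < k" for t j
  proof -
    have "ev (C $$ (i, j)) $$ (t, i) =
        (if i = j then A $$ (t, j) else 0) - (if i = t then A $$ (t, j) else 0)" if "i < k" for i
    proof -
      have "C $$ (i, j) = (if i = j then [:0, 1:] else 0) - [:A $$ (i, j):]"
        unfolding C_def char_poly_matrix_def using that \<open>j < k\<close> A by auto
      then show ?thesis
        using that \<open>t < k\<close> \<open>j < k\<close> A by (auto simp: ev_minus ev_X ev_pCons)
    qed
    with that show ?thesis by (simp add: sum_subtractf)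
  qed
  have "ev (char_poly A) $$ (r, l) = (\<Sum>i<k. if i = l then ev (char_poly A) $$ (r, i) else 0)"
    using rl by simp
  also have "\<dots> = (\<Sum>i<k. ev (\<Sum>j<k. Q $$ (j, l) * C $$ (i, j)) $$ (r, i))"
  proof (rule sum.cong[OF refl])
    fix i assume "i \<in> {..<k}"
    then have i: "i < k" by simp
    have "(\<Sum>j<k. Q $$ (j, l) * C $$ (i, j)) = (C * Q) $$ (i, l)"
      using i rl C Q by (simp add: scalar_prod_def atLeast0LessThan mult.commute)
    also have "\<dots> = (if i = l then char_poly A else 0)"
      using i rl by (simp add: CQ)
    finally show "(if i = l then ev (char_poly A) $$ (r, i) else 0) =
        ev (\<Sum>j<k. Q $$ (j, l) * C $$ (i, j)) $$ (r, i)"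
      using i rl by simp
  qed
  also have "\<dots> = (\<Sum>i<k. \<Sum>j<k. \<Sum>t<k. ev (Q $$ (j, l)) $$ (r, t) * ev (C $$ (i, j)) $$ (t, i))"
    using rl by (simp add: ev_sum_index ev_mult scalar_prod_def atLeast0LessThan)
  also have "\<dots> = (\<Sum>j<k. \<Sum>i<k. \<Sum>t<k. ev (Q $$ (j, l)) $$ (r, t) * ev (C $$ (i, j)) $$ (t, i))"
    by (rule sum.swap)
  also have "\<dots> = (\<Sum>j<k. \<Sum>t<k. ev (Q $$ (j, l)) $$ (r, t) * (\<Sum>i<k. ev (C $$ (i, j)) $$ (t, i)))"
    unfolding sum_distrib_left by (intro sum.cong[OF refl] sum.swap)
  also have "\<dots> = 0" by (simp add: col_C)
  finally show "ev (char_poly A) $$ (r, l) = 0\<^sub>m k k $$ (r, l)" using rl by simp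
qed simp_all

lemma ev_cong:
  assumes "[p = q] (mod char_poly A)"
  shows "ev p = ev q"
proof -
  obtain h where h: "p = q + char_poly A * h"
    using assms by (metis cong_iff_dvd_diff dvdE diff_eq_eq add.commute)
  show ?thesis
    unfolding h by (intro eq_matI) (simp_all add: ev_add ev_mult cayley_hamilton left_mult_zero_mat[OF ev_closed])
qed

text \<open>The polynomials that annihilate \<open>v\<close> form an ideal containing the characteristic polynomial.
  Statements about generalized eigenvectors thereby become divisibility statements.\<close>

definition annihilates :: "complex poly \<Rightarrow> complex vec \<Rightarrow> bool" where
  "annihilates p v \<longleftrightarrow> ev p *\<^sub>v v = 0\<^sub>v k"

lemma ev_mult_vec: "v \<in> carrier_vec k \<Longrightarrow> ev (p * q) *\<^sub>v v = ev p *\<^sub>v (ev q *\<^sub>v v)"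
  by (simp add: ev_mult assoc_mult_mat_vec[OF ev_closed ev_closed])

lemma ev_vec_closed: "v \<in> carrier_vec k \<Longrightarrow> ev p *\<^sub>v v \<in> carrier_vec k"
  by (rule mult_mat_vec_carrier[OF ev_closed])

lemma ev_add_vec: "v \<in> carrier_vec k \<Longrightarrow> ev (p + q) *\<^sub>v v = ev p *\<^sub>v v + ev q *\<^sub>v v"
  by (simp add: ev_add add_mult_distrib_mat_vec[OF ev_closed ev_closed])

lemma ev_minus_vec: "v \<in> carrier_vec k \<Longrightarrow> ev (p - q) *\<^sub>v v = ev p *\<^sub>v v - ev q *\<^sub>v v"
  by (simp add: ev_minus minus_mult_distrib_mat_vec[OF ev_closed ev_closed])

lemma annihilates_zero [simp]: "v \<in> carrier_vec k \<Longrightarrow> annihilates 0 v"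
  by (auto simp: annihilates_def)

lemma annihilates_add:
  "v \<in> carrier_vec k \<Longrightarrow> annihilates p v \<Longrightarrow> annihilates q v \<Longrightarrow> annihilates (p + q) v"
  by (simp add: annihilates_def ev_add_vec)

lemma annihilates_dvd:
  "v \<in> carrier_vec k \<Longrightarrow> annihilates p v \<Longrightarrow> p dvd q \<Longrightarrow> annihilates q v"
  by (auto simp: annihilates_def mult.commute[of p] ev_mult_vec mult_mat_zero_vec[OF ev_closed] elim!: dvdE)

lemma annihilates_sum:
  "v \<in> carrier_vec k \<Longrightarrow> (\<And>x. x \<in> S \<Longrightarrow> annihilates (f x) v) \<Longrightarrow> annihilates (sum f S) v"
  by (induction S rule: infinite_finite_induct) (simp_all add: annihilates_add)

lemma annihilates_minus_iff:
  assumes "v \<in> carrier_vec k"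
  shows "annihilates (p - q) v \<longleftrightarrow> ev p *\<^sub>v v = ev q *\<^sub>v v"
proof -
  have "ev p *\<^sub>v v = ev q *\<^sub>v v" if "ev p *\<^sub>v v - ev q *\<^sub>v v = 0\<^sub>v k"
  proof (rule eq_vecI)
    fix i assume "i < dim_vec (ev q *\<^sub>v v)"
    then have "i < k" by simp
    with arg_cong[OF that, of "\<lambda>w. w $ i"] show "(ev p *\<^sub>v v) $ i = (ev q *\<^sub>v v) $ i" by simp
  qed simp
  then show ?thesis using ev_vec_closed[OF assms]
    by (auto simp: annihilates_def ev_minus_vec assms)
qed

lemma gen_eigenspace_iff:
  "v \<in> gen_eigenspace A a \<longleftrightarrow> v \<in> carrier_vec k \<and> (\<exists>n. annihilates ([:- a, 1:] ^ n) v)"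
  by (auto simp: gen_eigenspace_def mat_kernel_def annihilates_def simp flip: ev_linear ev_power)

lemma ev_sum_vec_index:
  assumes "v \<in> carrier_vec k" "r < k"
  shows "(ev (sum f S) *\<^sub>v v) $ r = (\<Sum>x\<in>S. (ev (f x) *\<^sub>v v) $ r)"
  using assms by (induction S rule: infinite_finite_induct) (auto simp: ev_add_vec)

lemma annihilates_finsum_vec:
  assumes "finite E" "\<And>b. b \<in> E \<Longrightarrow> v b \<in> carrier_vec k" "\<And>b. b \<in> E \<Longrightarrow> annihilates p (v b)"
  shows "annihilates p (finsum_vec TYPE(complex) k v E)"
  using assms
proof (induction E rule: finite_induct)
  case empty
  show ?case by (simp add: annihilates_def finsum_vec_empty mult_mat_zero_vec[OF ev_closed])
next
  case (insert b E)
  have cl: "finsum_vec TYPE(complex) k v E \<in> carrier_vec k"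
    using insert.prems by (intro finsum_vec_closed) auto
  have "finsum_vec TYPE(complex) k v (insert b E) = v b + finsum_vec TYPE(complex) k v E"
    using insert.hyps insert.prems by (intro finsum_vec_insert) auto
  moreover have "ev p *\<^sub>v (v b + finsum_vec TYPE(complex) k v E) =
      ev p *\<^sub>v v b + ev p *\<^sub>v finsum_vec TYPE(complex) k v E"
    using insert.prems cl by (intro mult_add_distrib_mat_vec[OF ev_closed]) auto
  ultimately show ?case using insert.IH insert.prems by (simp add: annihilates_def)
qed

end

section \<open>Diagonalizability and generalized eigenvectors\<close>

lemma diagonal_mat_jordan_matrix_of_size_one:
  assumes "\<And>n a. (n, a) \<in> set n_as \<Longrightarrow> n \<le> 1"
  shows "diagonal_mat (jordan_matrix n_as :: complex mat)"
  using assms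
proof (induction n_as)
  case Nil
  show ?case by (simp add: jordan_matrix_def diagonal_mat_def)
next
  case (Cons na n_as)
  obtain n a where na: "na = (n, a)" by force
  have "n \<le> 1" using Cons.prems[of n a] by (simp add: na)
  have "diagonal_mat (jordan_matrix n_as :: complex mat)"
    using Cons.prems by (intro Cons.IH) auto
  then show ?case
    using \<open>n \<le> 1\<close> unfolding jordan_matrix_def diagonal_mat_def na
    by (auto simp: Let_def jordan_block_def)
qed

text \<open>In a Jordan normal form, a block of size at least \<open>2\<close> for \<open>a\<close> makes the kernel of
  \<open>(D - a)\<^sup>2\<close> larger than that of \<open>D - a\<close>: the two dimensions are the sums of \<open>min 2 n\<close> and of
  \<open>min 1 n\<close> over the sizes \<open>n\<close> of these blocks. So the hypothesis leaves only blocks of size \<open>1\<close>.\<close>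

lemma diagonalizable_if_generalized_eigenvectors_are_eigenvectors:
  assumes D: "D \<in> carrier_mat k k"
    and ker: "\<And>a v. v \<in> carrier_vec k \<Longrightarrow>
      char_matrix D a *\<^sub>v (char_matrix D a *\<^sub>v v) = 0\<^sub>v k \<Longrightarrow> char_matrix D a *\<^sub>v v = 0\<^sub>v k"
  shows "diagonalizable_mat D"
proof -
  obtain as where "char_poly D = (\<Prod>a\<leftarrow>as. [:- a, 1:])"
    using char_poly_factorized[OF D] by blast
  from jordan_nf_exists[OF D this] obtain n_as where jnf: "jordan_nf D n_as" by blast
  have "n \<le> 1" if "(n, a) \<in> set n_as" for n a
  proof -
    let ?C = "char_matrix D a"
    have C: "?C \<in> carrier_mat k k" using D by simp
    have pow1: "?C ^\<^sub>m 1 = ?C" using C by simp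
    have pow2: "?C ^\<^sub>m 2 = ?C * ?C" using C by (simp add: numeral_2_eq_2)
    have "mat_kernel (?C ^\<^sub>m 2) = mat_kernel (?C ^\<^sub>m 1)"
      unfolding pow1 pow2 mat_kernel[OF C] mat_kernel[OF mult_carrier_mat[OF C C]]
      using ker mult_mat_zero_vec[OF C] by (auto simp: assoc_mult_mat_vec[OF C C])
    then have "dim_gen_eigenspace D a 2 = dim_gen_eigenspace D a 1"
      unfolding dim_gen_eigenspace_def kernel_dim_def using C by (simp add: pow_mat_dim)
    then have eq: "(\<Sum>n\<leftarrow>map fst [(n, e)\<leftarrow>n_as . e = a]. min 2 n) = (\<Sum>n\<leftarrow>map fst [(n, e)\<leftarrow>n_as . e = a]. min 1 n)"
      unfolding dim_gen_eigenspace[OF jnf] .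
    \<comment> \<open>The sums agree and the summands on the right are no larger, so all summands agree.\<close>
    have "min 2 n \<le> min 1 n" if "(\<Sum>n\<leftarrow>ns. min 2 n) = (\<Sum>n\<leftarrow>ns. min 1 n)" "n \<in> set ns" for ns and n :: nat
    proof -
      have le: "(\<Sum>n\<leftarrow>xs. min 1 n) \<le> (\<Sum>n\<leftarrow>xs. min 2 n)" for xs :: "nat list"
        by (rule sum_list_mono) simp
      from split_list[OF that(2)] obtain xs ys where "ns = xs @ n # ys" by blast
      with that(1) le[of xs] le[of ys] show ?thesis by simp
    qed
    from this[OF eq, of n] \<open>(n, a) \<in> set n_as\<close> have "min 2 n \<le> min 1 n" by force
    then show ?thesis by simp
  qed
  then have "diagonal_mat (jordan_matrix n_as)" by (rule diagonal_mat_jordan_matrix_of_size_one)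
  moreover have "similar_mat D (jordan_matrix n_as)" using jnf by (simp add: jordan_nf_def)
  ultimately show ?thesis unfolding diagonalizable_mat_def by blast
qed

lemma char_matrix_mult_vec:
  assumes "A \<in> carrier_mat k k" "v \<in> carrier_vec k"
  shows "char_matrix A a *\<^sub>v v = A *\<^sub>v v - a \<cdot>\<^sub>v v"
proof -
  have "char_matrix A a *\<^sub>v v = A *\<^sub>v v + ((- a) \<cdot>\<^sub>m 1\<^sub>m k) *\<^sub>v v"
    using assms unfolding char_matrix_def
    by (simp add: add_mult_distrib_mat_vec[where nr = k and nc = k])
  also have "((- a) \<cdot>\<^sub>m 1\<^sub>m k) *\<^sub>v v = (- a) \<cdot>\<^sub>v v"
    by (rule scalar_mat_mult_vec[OF assms(2)])
  finally show ?thesis using assms by (auto intro!: eq_vecI)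
qed

text \<open>On the \<open>a\<close>-eigenspace of \<open>D\<close>, which \<open>N\<close> preserves because it commutes with \<open>D\<close>, the matrix
  \<open>D + N - a\<close> acts as \<open>N\<close>. So if \<open>N\<close> is nilpotent, eigenvectors of \<open>D\<close> are generalized
  eigenvectors of \<open>D + N\<close>; this is the key to uniqueness.\<close>

lemma eigenvector_of_semisimple_part:
  assumes D: "D \<in> carrier_mat k k" and N: "N \<in> carrier_mat k k" and comm: "D * N = N * D"
    and v: "v \<in> carrier_vec k" and eig: "D *\<^sub>v v = a \<cdot>\<^sub>v v"
  shows "char_matrix (D + N) a ^\<^sub>m l *\<^sub>v v = N ^\<^sub>m l *\<^sub>v v"
  using v eig
proof (induction l arbitrary: v)
  case 0
  have "char_matrix (D + N) a \<in> carrier_mat k k" using D N by simp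
  from carrier_matD(1)[OF this] N 0 show ?case by simp
next
  case (Suc l)
  let ?C = "char_matrix (D + N) a"
  have C: "?C \<in> carrier_mat k k" using D N by simp
  have Nv: "N *\<^sub>v v \<in> carrier_vec k" using N Suc.prems by simp
  have "?C *\<^sub>v v = D *\<^sub>v v + N *\<^sub>v v - a \<cdot>\<^sub>v v"
    using D N Suc.prems(1) by (simp add: char_matrix_mult_vec[where k = k] add_mult_distrib_mat_vec[OF D N])
  also have "\<dots> = N *\<^sub>v v"
    unfolding Suc.prems(2) using N Suc.prems(1) by (intro eq_vecI) auto
  finally have Cv: "?C *\<^sub>v v = N *\<^sub>v v" .
  have "D *\<^sub>v (N *\<^sub>v v) = N *\<^sub>v (D *\<^sub>v v)"
    using assoc_mult_mat_vec[OF D N Suc.prems(1)] assoc_mult_mat_vec[OF N D Suc.prems(1)] comm by simp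
  also have "\<dots> = a \<cdot>\<^sub>v (N *\<^sub>v v)"
    unfolding Suc.prems(2) by (rule mult_mat_vec[OF N Suc.prems(1)])
  finally have "?C ^\<^sub>m l *\<^sub>v (N *\<^sub>v v) = N ^\<^sub>m l *\<^sub>v (N *\<^sub>v v)"
    using Suc.IH[OF Nv] by simp
  then show ?case
    using assoc_mult_mat_vec[OF pow_carrier_mat[OF C] C Suc.prems(1)]
      assoc_mult_mat_vec[OF pow_carrier_mat[OF N] N Suc.prems(1)] by (simp add: Cv)
qed

section \<open>Decomposition and spectral projections\<close>

locale factored_matrix = complex_square_matrix k A + factorisation s \<alpha> m for k A s \<alpha> m +
  assumes char_poly_eq: "char_poly A = P"
begin

lemma ev_cong_P: "[p = q] (mod P) \<Longrightarrow> ev p = ev q"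
  using ev_cong char_poly_eq by simp

lemma annihilates_cong_P: "[p = q] (mod P) \<Longrightarrow> annihilates q v \<Longrightarrow> annihilates p v"
  by (simp add: annihilates_def ev_cong_P)

lemma linear_power_L0_cong_zero:
  assumes "j \<in> {1..s}"
  shows "[[:- \<alpha> j, 1:] ^ m j * L j 0 = 0] (mod P)"
  unfolding cong_0_iff prod_eq_cofactor[OF assms] L_poly_def by (intro mult_dvd_mono dvd_mult2 dvd_refl)

text \<open>The vector \<open>w = L j 0 (A) v\<close> is killed both by a power of \<open>A - a\<close> and by \<open>(A - \<alpha> j) ^ m j\<close>.
  These two polynomials in \<open>A\<close> come from coprime polynomials, hence \<open>w = 0\<close>.\<close>

lemma L0_annihilates_other_gen_eigenspace:
  assumes v: "v \<in> gen_eigenspace A a" and j: "j \<in> {1..s}" "\<alpha> j \<noteq> a"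
  shows "annihilates (L j 0) v"
proof -
  from v obtain n where vc: "v \<in> carrier_vec k" and n: "annihilates ([:- a, 1:] ^ n) v"
    by (auto simp: gen_eigenspace_iff)
  let ?x = "[:- a, 1:] ^ n" and ?y = "[:- \<alpha> j, 1:] ^ m j"
  have "coprime ?x ?y" using j by (intro coprime_linear_powers) auto
  then obtain u w where "u * ?x + w * ?y = 1"
    by (metis bezout_coefficients_fst_snd coprime_imp_gcd_eq_1)
  then have "L j 0 = (u * ?x + w * ?y) * L j 0" by simp
  also have "\<dots> = ?x * (u * L j 0) + w * (?y * L j 0)" by (simp only: algebra_simps)
  finally have L: "L j 0 = ?x * (u * L j 0) + w * (?y * L j 0)" .
  have "annihilates (?x * (u * L j 0)) v"
    using annihilates_dvd[OF vc n dvd_triv_left] .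
  moreover have "annihilates (w * (?y * L j 0)) v"
    using annihilates_cong_P[OF linear_power_L0_cong_zero[OF j(1)], of v] vc
    by (auto intro: annihilates_dvd[OF vc])
  ultimately show ?thesis
    by (subst L) (rule annihilates_add[OF vc])
qed

text \<open>Since the \<open>L i 0\<close> sum to \<open>1\<close>, the polynomial \<open>interp c - d\<close> is the sum of the
  \<open>(c i - d) L i 0\<close> modulo \<open>P\<close>, and each summand is zero or annihilates \<open>v\<close>.
  If \<open>a\<close> is none of the \<open>\<alpha> i\<close>, the hypothesis on \<open>c\<close> is void and the conclusion holds for
  every \<open>d\<close>: the generalized eigenspace is then \<open>0\<close>.\<close>

lemma interp_on_gen_eigenspace:
  assumes v: "v \<in> gen_eigenspace A a" and c: "\<And>i. i \<in> {1..s} \<Longrightarrow> \<alpha> i = a \<Longrightarrow> c i = d"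
  shows "ev (interp c) *\<^sub>v v = d \<cdot>\<^sub>v v"
proof -
  have vc: "v \<in> carrier_vec k" using v by (simp add: gen_eigenspace_iff)
  have "[interp c - [:d:] = interp (\<lambda>i. c i - d)] (mod P)"
  proof (rule interp_unique)
    fix i assume i: "i \<in> {1..s}"
    have "[interp c - [:d:] = [:c i:] - [:d:]] (mod [:- \<alpha> i, 1:] ^ m i)"
      by (intro cong_diff cong_refl interp_cong i)
    then show "[interp c - [:d:] = [:c i - d:]] (mod [:- \<alpha> i, 1:] ^ m i)" by simp
  qed
  moreover have "annihilates (interp (\<lambda>i. c i - d)) v"
    unfolding interp_def
  proof (rule annihilates_sum[OF vc])
    fix i assume i: "i \<in> {1..s}"
    show "annihilates (smult (c i - d) (L i 0)) v"
    proof (cases "\<alpha> i = a")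
      case True
      with c[OF i] vc show ?thesis by simp
    next
      case False
      from annihilates_dvd[OF vc L0_annihilates_other_gen_eigenspace[OF v i this]]
      show ?thesis by (simp add: dvd_smult)
    qed
  qed
  ultimately have "annihilates (interp c - [:d:]) v" by (rule annihilates_cong_P)
  then have "ev (interp c) *\<^sub>v v = ev [:d:] *\<^sub>v v" by (simp add: annihilates_minus_iff[OF vc])
  also have "ev [:d:] = d \<cdot>\<^sub>m 1\<^sub>m k" using A by (intro eq_matI) (auto simp: ev_pCons)
  finally show ?thesis by (simp add: scalar_mat_mult_vec[OF vc])
qed

text \<open>Let \<open>f = interp c - a\<close>. Modulo each factor of \<open>P\<close> it is a constant, and for a constant \<open>y\<close> in a
  field \<open>y = inverse y * y\<^sup>2\<close>, also when \<open>y = 0\<close>. So \<open>f\<close> is a multiple of \<open>f\<^sup>2\<close> modulo \<open>P\<close>, and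
  whatever \<open>f\<^sup>2\<close> annihilates is annihilated by \<open>f\<close>.\<close>

lemma ev_interp_diagonalizable: "diagonalizable_mat (ev (interp c))"
proof (rule diagonalizable_if_generalized_eigenvectors_are_eigenvectors[OF ev_closed])
  fix a v
  let ?C = "char_matrix (ev (interp c)) a" and ?f = "interp c - [:a:]"
  assume v: "v \<in> carrier_vec k" and *: "?C *\<^sub>v (?C *\<^sub>v v) = 0\<^sub>v k"
  have C: "?C = ev ?f"
    using A by (intro eq_matI) (auto simp: char_matrix_def ev_minus ev_pCons)
  from * have "annihilates (?f * ?f) v"
    using v by (simp add: C annihilates_def ev_mult_vec)
  then have ann: "annihilates (interp (\<lambda>i. inverse (c i - a)) * (?f * ?f)) v"
    by (rule annihilates_dvd[OF v]) simp
  have "[?f = interp (\<lambda>i. inverse (c i - a)) * (?f * ?f)] (mod P)"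
  proof (rule cong_prod_polyI)
    fix i assume i: "i \<in> {1..s}"
    have f: "[?f = [:c i:] - [:a:]] (mod [:- \<alpha> i, 1:] ^ m i)"
      by (intro cong_diff cong_refl interp_cong i)
    have "[interp (\<lambda>i. inverse (c i - a)) * (?f * ?f) =
        [:inverse (c i - a):] * (([:c i:] - [:a:]) * ([:c i:] - [:a:]))] (mod [:- \<alpha> i, 1:] ^ m i)"
      by (intro cong_mult f interp_cong i)
    also have "[:inverse (c i - a):] * (([:c i:] - [:a:]) * ([:c i:] - [:a:])) = [:c i:] - [:a:]"
      by (cases "c i = a") simp_all
    finally show "[?f = interp (\<lambda>i. inverse (c i - a)) * (?f * ?f)] (mod [:- \<alpha> i, 1:] ^ m i)"
      using f cong_sym cong_trans by blast
  qed
  from annihilates_cong_P[OF this ann] show "?C *\<^sub>v v = 0\<^sub>v k"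
    by (simp add: C annihilates_def)
qed

text \<open>For uniqueness, let \<open>A = D' + N'\<close> be another decomposition and let the columns of \<open>S\<close> be a basis
  of eigenvectors of \<open>D'\<close>. A column with eigenvalue \<open>a\<close> lies in the generalized eigenspace of \<open>A\<close>
  at \<open>a\<close>, where \<open>interp \<alpha>\<close> acts as the scalar \<open>a\<close>. Hence both diagonalizable parts agree on a
  basis.\<close>

lemma chevalley_jordan_decomposition:
  "is_chevalley_jordan_decomposition k A (ev (interp \<alpha>)) (ev ([:0, 1:] - interp \<alpha>))"
proof -
  let ?D = "ev (interp \<alpha>)" and ?N = "ev ([:0, 1:] - interp \<alpha>)"
  have sum: "A = ?D + ?N" by (simp flip: ev_add add: ev_X)
  have "?N ^\<^sub>m (\<Sum>i\<in>{1..s}. m i) = 0\<^sub>m k k"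
    using ev_cong_P[OF nilpotent_poly] by (simp flip: ev_power)
  then have "chevalley_jordan_pair k A ?D ?N"
    unfolding chevalley_jordan_pair_def nilpotent_mat_def
    using sum ev_interp_diagonalizable ev_commute by auto
  moreover have "D' = ?D \<and> N' = ?N" if "chevalley_jordan_pair k A D' N'" for D' N'
  proof -
    from that have D': "D' \<in> carrier_mat k k" and N': "N' \<in> carrier_mat k k" and A': "A = D' + N'"
      and comm: "D' * N' = N' * D'" and "diagonalizable_mat D'" "nilpotent_mat k N'"
      unfolding chevalley_jordan_pair_def by auto
    then obtain n E S Q where n: "N' ^\<^sub>m n = 0\<^sub>m k k" and diag: "diagonal_mat E"
      and wit: "similar_mat_wit D' E S Q"
      unfolding diagonalizable_mat_def nilpotent_mat_def similar_mat_def by blast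
    from similar_mat_witD2[OF D' wit] have E: "E \<in> carrier_mat k k" and S: "S \<in> carrier_mat k k"
      and Q: "Q \<in> carrier_mat k k" and SQ: "S * Q = 1\<^sub>m k" and QS: "Q * S = 1\<^sub>m k" and "D' = S * E * Q"
      by auto
    have D'S: "D' * S = S * E"
    proof -
      have "D' * S = S * E * (Q * S)"
        unfolding \<open>D' = S * E * Q\<close> by (rule assoc_mult_mat[OF mult_carrier_mat[OF S E] Q S])
      then show ?thesis using S E by (simp add: QS)
    qed
    have "?D * S = D' * S"
    proof (rule mat_col_eqI)
      fix j assume "j < dim_col (D' * S)"
      then have j: "j < k" using S by simp
      let ?v = "col S j"
      have v: "?v \<in> carrier_vec k" using S by (rule col_carrier_vec[OF j])
      have "D' *\<^sub>v ?v = col (S * E) j"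
        using j col_mult2[OF D' S] by (simp flip: D'S)
      also have "\<dots> = E $$ (j, j) \<cdot>\<^sub>v ?v"
      proof (rule eq_vecI)
        fix i assume "i < dim_vec (E $$ (j, j) \<cdot>\<^sub>v ?v)"
        then have i: "i < k" using S by simp
        have "col (S * E) j $ i = (\<Sum>l<k. S $$ (i, l) * E $$ (l, j))"
          using i j S E by (simp add: scalar_prod_def atLeast0LessThan)
        also have "\<dots> = (\<Sum>l<k. if l = j then S $$ (i, l) * E $$ (l, j) else 0)"
          using diag E j by (intro sum.cong) (auto simp: diagonal_mat_def)
        also have "\<dots> = (E $$ (j, j) \<cdot>\<^sub>v ?v) $ i"
          using i j S by simp
        finally show "col (S * E) j $ i = (E $$ (j, j) \<cdot>\<^sub>v ?v) $ i" .
      qed (use S E in simp)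
      finally have eig: "D' *\<^sub>v ?v = E $$ (j, j) \<cdot>\<^sub>v ?v" .
      have "char_matrix A (E $$ (j, j)) ^\<^sub>m n *\<^sub>v ?v = 0\<^sub>v k"
        unfolding A' eigenvector_of_semisimple_part[OF D' N' comm v eig] n
        using v by (intro eq_vecI) auto
      then have "?v \<in> gen_eigenspace A (E $$ (j, j))"
        using v by (auto simp: gen_eigenspace_iff annihilates_def ev_power ev_linear)
      then have "?D *\<^sub>v ?v = D' *\<^sub>v ?v"
        unfolding eig by (rule interp_on_gen_eigenspace)
      then show "col (?D * S) j = col (D' * S) j"
        using j by (simp add: col_mult2[OF ev_closed S] col_mult2[OF D' S])
    qed (use S D' in auto)
    then have "?D * S * Q = D' * S * Q" by simp
    then have DD: "?D = D'"
      using D' by (simp add: assoc_mult_mat[OF ev_closed S Q] assoc_mult_mat[OF D' S Q] SQ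
        right_mult_one_mat[OF ev_closed])
    have "N' = ?N"
    proof (rule eq_matI)
      fix i j assume "i < dim_row ?N" "j < dim_col ?N"
      then have "i < k" "j < k" by auto
      then have "(?D + ?N) $$ (i, j) = (D' + N') $$ (i, j)" using A' sum by simp
      then show "N' $$ (i, j) = ?N $$ (i, j)"
        using \<open>i < k\<close> \<open>j < k\<close> N' by (simp add: DD)
    qed (use N' in auto)
    with DD show ?thesis by simp
  qed
  ultimately show ?thesis unfolding is_chevalley_jordan_decomposition_def by blast
qed

lemma eigenvalue_iff: "eigenvalue A b \<longleftrightarrow> (\<exists>i\<in>{1..s}. m i > 0 \<and> b = \<alpha> i)"
  unfolding eigenvalue_root_char_poly[OF A] char_poly_eq prod_poly_def
  by (auto simp: poly_prod)

text \<open>The range is found from the action of \<open>L j 0\<close> on generalized eigenvectors. A vector \<open>w\<close> in the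
  kernel is the sum of its components \<open>L i 0 (A) w\<close> with \<open>i \<noteq> j\<close>. Listed points with
  \<open>m i = 0\<close> are not eigenvalues, but their components are \<open>0\<close>, so the sum can be indexed by the
  eigenvalues other than \<open>\<alpha> j\<close>.\<close>

lemma spectral_projection:
  assumes j: "j \<in> {1..s}"
  shows "is_spectral_projection k A (\<alpha> j) (ev (L j 0))"
proof -
  let ?B = "ev (L j 0)"
  define E where "E = {b. eigenvalue A b \<and> b \<noteq> \<alpha> j}"
  define I where "I = {i \<in> {1..s}. m i > 0 \<and> i \<noteq> j}"
  have E_eq: "E = \<alpha> ` I"
    using inj j by (auto simp: E_def I_def eigenvalue_iff dest: inj_onD)
  have inj_I: "inj_on \<alpha> I" using inj by (rule inj_on_subset) (auto simp: I_def)
  have "finite E" by (simp add: E_eq I_def)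
  have gen: "ev (L i 0) *\<^sub>v v \<in> gen_eigenspace A (\<alpha> i)" if "i \<in> {1..s}" "v \<in> carrier_vec k" for i v
  proof -
    have "annihilates ([:- \<alpha> i, 1:] ^ m i * L i 0) v"
      using that by (intro annihilates_cong_P[OF linear_power_L0_cong_zero]) auto
    then have "annihilates ([:- \<alpha> i, 1:] ^ m i) (ev (L i 0) *\<^sub>v v)"
      using that by (simp add: annihilates_def ev_mult_vec)
    then show ?thesis using that by (auto simp: gen_eigenspace_iff ev_vec_closed)
  qed
  have idem: "?B * ?B = ?B"
  proof -
    let ?c = "\<lambda>i. if i = j then 1 else 0 :: complex"
    have "(\<lambda>i. ?c i * ?c i) = ?c" by auto
    then have "ev (interp ?c * interp ?c) = ev (interp ?c)"
      using ev_cong_P[OF interp_mult[of ?c ?c]] by simp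
    then show ?thesis by (simp add: interp_unit[OF j] ev_mult)
  qed
  have range: "(\<lambda>v. ?B *\<^sub>v v) ` carrier_vec k = gen_eigenspace A (\<alpha> j)"
  proof
    show "(\<lambda>v. ?B *\<^sub>v v) ` carrier_vec k \<subseteq> gen_eigenspace A (\<alpha> j)" using gen[OF j] by auto
    show "gen_eigenspace A (\<alpha> j) \<subseteq> (\<lambda>v. ?B *\<^sub>v v) ` carrier_vec k"
    proof
      fix v assume v: "v \<in> gen_eigenspace A (\<alpha> j)"
      then have "ev (interp (\<lambda>i. if i = j then 1 else 0)) *\<^sub>v v = 1 \<cdot>\<^sub>v v"
        using inj j by (intro interp_on_gen_eigenspace) (auto dest: inj_onD)
      then have "v = ?B *\<^sub>v v" by (simp add: interp_unit[OF j])
      with v show "v \<in> (\<lambda>v. ?B *\<^sub>v v) ` carrier_vec k" by (auto simp: gen_eigenspace_iff)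
    qed
  qed
  have "mat_kernel ?B = {finsum_vec TYPE(complex) k v E | v. \<forall>b\<in>E. v b \<in> gen_eigenspace A b}"
  proof (intro equalityI subsetI)
    fix w assume "w \<in> mat_kernel ?B"
    then have w: "w \<in> carrier_vec k" and Bw: "?B *\<^sub>v w = 0\<^sub>v k"
      by (auto simp: mat_kernel[OF ev_closed])
    define v where "v b = ev (L (the_inv_into I \<alpha> b) 0) *\<^sub>v w" for b
    have v_\<alpha>: "v (\<alpha> i) = ev (L i 0) *\<^sub>v w" if "i \<in> I" for i
      using that by (simp add: v_def the_inv_into_f_f[OF inj_I])
    have v_gen: "v b \<in> gen_eigenspace A b" if "b \<in> E" for b
      using that w by (auto simp: E_eq v_\<alpha> I_def intro!: gen)
    then have v_closed: "v \<in> E \<rightarrow> carrier_vec k" by (auto simp: gen_eigenspace_iff)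
    have "w = finsum_vec TYPE(complex) k v E"
    proof (rule eq_vecI)
      show dim: "dim_vec w = dim_vec (finsum_vec TYPE(complex) k v E)"
        using finsum_vec_closed[OF v_closed] w by simp
      fix r assume "r < dim_vec (finsum_vec TYPE(complex) k v E)"
      then have r: "r < k" using dim w by simp
      have vanish: "(ev (L i 0) *\<^sub>v w) $ r = 0" if "i \<in> {1..s} - I" for i
      proof (cases "i = j")
        case True
        then show ?thesis using Bw r by simp
      next
        case False
        with that have "L i 0 = 0" by (simp add: I_def L_poly_def)
        then show ?thesis using r w by simp
      qed
      have "w $ r = (ev (interp (\<lambda>_. 1)) *\<^sub>v w) $ r"
        using ev_cong_P[OF interp_one] w by simp
      also have "\<dots> = (\<Sum>i\<in>{1..s}. (ev (L i 0) *\<^sub>v w) $ r)"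
        using w r by (simp add: interp_def ev_sum_vec_index del: index_mult_mat_vec)
      also have "\<dots> = (\<Sum>i\<in>I. v (\<alpha> i) $ r)"
        using vanish by (intro sum.mono_neutral_cong_right) (auto simp: I_def v_\<alpha>)
      also have "\<dots> = finsum_vec TYPE(complex) k v E $ r"
        using r v_closed \<open>finite E\<close> inj_I
        by (simp add: index_finsum_vec E_eq sum.reindex)
      finally show "w $ r = finsum_vec TYPE(complex) k v E $ r" .
    qed
    with v_gen show "w \<in> {finsum_vec TYPE(complex) k v E | v. \<forall>b\<in>E. v b \<in> gen_eigenspace A b}"
      by blast
  next
    fix w assume "w \<in> {finsum_vec TYPE(complex) k v E | v. \<forall>b\<in>E. v b \<in> gen_eigenspace A b}"
    then obtain v where w: "w = finsum_vec TYPE(complex) k v E"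
      and v: "\<And>b. b \<in> E \<Longrightarrow> v b \<in> gen_eigenspace A b" by blast
    then have closed: "v b \<in> carrier_vec k" if "b \<in> E" for b
      using that by (auto simp: gen_eigenspace_iff)
    have "annihilates (L j 0) w"
      unfolding w
    proof (rule annihilates_finsum_vec[OF \<open>finite E\<close> closed])
      fix b assume b: "b \<in> E"
      then show "annihilates (L j 0) (v b)"
        by (intro L0_annihilates_other_gen_eigenspace[OF v[OF b] j]) (auto simp: E_def)
    qed
    moreover have "w \<in> carrier_vec k"
      unfolding w using closed by (intro finsum_vec_closed) auto
    ultimately show "w \<in> mat_kernel ?B" by (simp add: mat_kernel[OF ev_closed] annihilates_def)
  qed
  with idem range show ?thesis
    unfolding is_spectral_projection_def is_projection_onto_along_def
      sum_other_gen_eigenspaces_def E_def Let_def by simp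
qed

lemma nilpotent_part: "ev ([:0, 1:] - interp \<alpha>) = finsum_mat k (\<lambda>j. ev (L j 1)) {1..s}"
proof -
  have "[(\<Sum>j\<in>{1..s}. L j 1) = (\<Sum>j\<in>{1..s}. [:- \<alpha> j, 1:] * L j 0)] (mod P)"
    by (rule cong_sum) (rule L1_cong)
  also have "(\<Sum>j\<in>{1..s}. [:- \<alpha> j, 1:] * L j 0) = [:0, 1:] * interp (\<lambda>_. 1) - interp \<alpha>"
    by (simp add: interp_def sum_distrib_left sum_subtractf)
  also have "[[:0, 1:] * interp (\<lambda>_. 1) - interp \<alpha> = [:0, 1:] * 1 - interp \<alpha>] (mod P)"
    by (intro cong_diff cong_mult cong_refl interp_one)
  finally have "ev (\<Sum>j\<in>{1..s}. L j 1) = ev ([:0, 1:] - interp \<alpha>)"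
    using ev_cong_P by (simp only: mult_1_right)
  then show ?thesis by (simp add: ev_sum)
qed

lemma diagonalizable_part: "ev (interp \<alpha>) = finsum_mat k (\<lambda>j. \<alpha> j \<cdot>\<^sub>m ev (L j 0)) {1..s}"
  unfolding interp_def by (simp add: ev_sum ev_smult)

end

theorem theorem3p3:
  fixes A :: "complex mat" and k s :: nat
    and \<alpha> :: "nat \<Rightarrow> complex" and m :: "nat \<Rightarrow> nat"
    and B :: "nat \<Rightarrow> nat \<Rightarrow> complex mat" and D N :: "complex mat"
  assumes "k \<ge> 1" and "A \<in> carrier_mat k k"
    and "s \<ge> 1" and "inj_on \<alpha> {1..s}" and "\<alpha> 1 = 0"
    and "\<And>j. j \<in> {2..s} \<Longrightarrow> m j \<ge> 1"
    and "char_poly A = prod_poly s \<alpha> m"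
    and "\<And>j r. j \<in> {1..s} \<Longrightarrow> r \<in> {0, 1} \<Longrightarrow> B j r = poly_mat k (L_poly s \<alpha> m j r) A"
    and "N = finsum_mat k (\<lambda>j. B j 1) {1..s}"
    and "D = finsum_mat k (\<lambda>j. \<alpha> j \<cdot>\<^sub>m B j 0) {2..s}"
  shows "is_chevalley_jordan_decomposition k A D N \<and>
    (\<forall>j\<in>{1..s}. is_spectral_projection k A (\<alpha> j) (B j 0))"
proof -
  interpret factored_matrix k A s \<alpha> m
    using assms(2,4,7) by unfold_locales
  have B: "B j 0 = ev (L j 0)" "B j 1 = ev (L j 1)" if "j \<in> {1..s}" for j
    using assms(8)[OF that] by auto
  have closed: "B j 0 \<in> carrier_mat k k" "B j 1 \<in> carrier_mat k k" if "j \<in> {1..s}" for j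
    using B[OF that] by auto
  have "N = ev ([:0, 1:] - interp \<alpha>)"
  proof -
    have N: "N \<in> carrier_mat k k"
      unfolding assms(9) using closed by (intro finsum_mat_closed) auto
    show ?thesis
    proof (rule eq_matI)
      fix i j assume "i < dim_row (ev ([:0, 1:] - interp \<alpha>))" "j < dim_col (ev ([:0, 1:] - interp \<alpha>))"
      then have ij: "i < k" "j < k" by auto
      have "N $$ (i, j) = (\<Sum>l\<in>{1..s}. B l 1 $$ (i, j))"
        unfolding assms(9) using ij closed by (intro index_finsum_mat) auto
      also have "\<dots> = (\<Sum>l\<in>{1..s}. ev (L l 1) $$ (i, j))"
        using B by (intro sum.cong) auto
      also have "\<dots> = ev ([:0, 1:] - interp \<alpha>) $$ (i, j)"
        unfolding nilpotent_part using ij by (intro index_finsum_mat[symmetric]) auto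
      finally show "N $$ (i, j) = ev ([:0, 1:] - interp \<alpha>) $$ (i, j)" .
    qed (use N in auto)
  qed
  moreover have "D = ev (interp \<alpha>)"
  proof -
    have split: "{1..s} = insert 1 {2..s}" using assms(3) by auto
    have sub: "{2..s} \<subseteq> {1..s}" by auto
    have D: "D \<in> carrier_mat k k"
      unfolding assms(10) using closed by (intro finsum_mat_closed) auto
    show ?thesis
    proof (rule eq_matI)
      fix i j assume "i < dim_row (ev (interp \<alpha>))" "j < dim_col (ev (interp \<alpha>))"
      then have ij: "i < k" "j < k" by auto
      have "D $$ (i, j) = (\<Sum>l\<in>{2..s}. (\<alpha> l \<cdot>\<^sub>m B l 0) $$ (i, j))"
        unfolding assms(10) using ij closed by (intro index_finsum_mat) auto
      also have "\<dots> = (\<Sum>l\<in>{2..s}. (\<alpha> l \<cdot>\<^sub>m ev (L l 0)) $$ (i, j))"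
        using B sub by (intro sum.cong) auto
      \<comment> \<open>The two index sets differ by \<open>1\<close>, whose summand vanishes because \<open>\<alpha> 1 = 0\<close>.\<close>
      also have "\<dots> = (\<Sum>l\<in>{1..s}. (\<alpha> l \<cdot>\<^sub>m ev (L l 0)) $$ (i, j))"
        unfolding split using assms(5) ij by simp
      also have "\<dots> = ev (interp \<alpha>) $$ (i, j)"
        unfolding diagonalizable_part using ij by (intro index_finsum_mat[symmetric]) auto
      finally show "D $$ (i, j) = ev (interp \<alpha>) $$ (i, j)" .
    qed (use D in auto)
  qed
  ultimately show ?thesis
    using chevalley_jordan_decomposition spectral_projection B by simp
qed

end
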